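(* The condition that $\sup_{n,m\in\mathbb{N}}\|A_{n,m}^\dagger A\|<\infty$, and hence also the convergence $A_{n,m}^\dagger Ax^\dagger\to x^\dagger$ as $n,m\to\infty$ for all $x^\dagger\in N(A)^\perp$, holds if and only if there exists a constant $C$ such that for all $x\in X$ and all $n,m\in\mathbb{N}$ there exists $u\in X_n$ with $$\|x-u\|+\|A_{n,m}^\dagger A(x-u)\|\le C\|x\|.$$ In particular, in the case where $Q_m=I$, with $A_n:=AP_n$: if there exists a constant $C$ such that for all $x\in N(A)^\perp$ and all $n\in\mathbb{N}$ there exists $u_n\in X_n$ with $$\|x-u_n\|+\|A_n^\dagger\|\,\|A(x-u_n)\|\le C\|x\|,$$ then $\sup_n\|A_n^\dagger A\|<\infty$, and thus $A_n^\dagger Ax^\dagger\to x^\dagger$ as $n\to\infty$ for all $x^\dagger\in N(A)^\perp$.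
   Context: $X,Y$ are Hilbert spaces and $A:X\to Y$ is a bounded linear operator. $(X_n)_{n\in\mathbb{N}}$ and $(Y_m)_{m\in\mathbb{N}}$ are sequences of finite-dimensional subspaces $X_n\subset X$, $Y_m\subset Y$ with $X_n\subset X_{n+1}$, $\overline{\bigcup_n X_n}=X$, $Y_m\subset Y_{m+1}$, $\overline{\bigcup_m Y_m}=Y$. $P_n$ is the orthogonal projector of $X$ onto $X_n$ and $Q_m$ the orthogonal projector of $Y$ onto $Y_m$. $A_{n,m}:=Q_mAP_n:X\to Y$. $N(T)$ denotes the nullspace of an operator $T$, and $T^\dagger$ the Moore–Penrose pseudoinverse of an operator $T$ with closed range ($T^\dagger y$ is the minimum-norm least-squares solution of $Tx=y$). Norms of operators are operator norms; "as $n,m\to\infty$" means the joint limit with both indices tending to infinity independently. *)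

theory Defs
  imports "HOL-Analysis.Analysis"
begin

text \<open>
  Hilbert spaces are types of class \<open>{real_inner, complete_space}\<close>.  A complex Hilbert space is
  such a space under the real part of its inner product; complex subspaces have the same orthogonal
  complements and projectors with respect to either product, and norms agree, so the complex
  case is covered as well.
\<close>

definition nullspace :: "('a::real_vector \<Rightarrow> 'b::real_vector) \<Rightarrow> 'a set" where
  "nullspace T = {x. T x = 0}"

definition finite_dim_subspace :: "'a::real_vector set \<Rightarrow> bool" where
  "finite_dim_subspace S \<longleftrightarrow> subspace S \<and> (\<exists>B. finite B \<and> span B = S)"

definition approximating_subspaces :: "(nat \<Rightarrow> 'a::real_normed_vector set) \<Rightarrow> bool" where
  "approximating_subspaces X \<longleftrightarrow>
     (\<forall>n. finite_dim_subspace (X n)) \<and> (\<forall>n. X n \<subseteq> X (Suc n)) \<and> closure (\<Union>n. X n) = UNIV"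

text \<open>
  The library's \<open>closest_point\<close> requires a Heine-Borel space, hence a projector of our own.
  The point below exists and is unique for every complete subspace, in particular for every
  finite-dimensional one.
\<close>

definition orth_projector :: "'a::real_inner set \<Rightarrow> 'a \<Rightarrow> 'a" where
  "orth_projector S x = (THE p. p \<in> S \<and> x - p \<in> orthogonal_comp S)"

definition least_squares_solution ::
    "('a::real_inner \<Rightarrow> 'b::real_inner) \<Rightarrow> 'b \<Rightarrow> 'a \<Rightarrow> bool" where
  "least_squares_solution T y x \<longleftrightarrow> (\<forall>z. norm (T x - y) \<le> norm (T z - y))"

text \<open>
  The minimum-norm least-squares solution exists and is unique for every right-hand side if \<open>T\<close> is
  a bounded linear operator with closed range between Hilbert spaces; the operators of
  interest here have finite rank.
\<close>

definition pseudoinverse ::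
    "('a::real_inner \<Rightarrow> 'b::real_inner) \<Rightarrow> 'b \<Rightarrow> 'a" where
  "pseudoinverse T y = (THE x. least_squares_solution T y x \<and>
     (\<forall>z. least_squares_solution T y z \<longrightarrow> norm x \<le> norm z))"

definition projected_operator ::
    "('a::real_inner \<Rightarrow> 'b::real_inner) \<Rightarrow> (nat \<Rightarrow> 'a set) \<Rightarrow> (nat \<Rightarrow> 'b set) \<Rightarrow>
      nat \<Rightarrow> nat \<Rightarrow> 'a \<Rightarrow> 'b" where
  "projected_operator A X Y n m = orth_projector (Y m) \<circ> A \<circ> orth_projector (X n)"

end

theory Submission
  imports Defs
begin

text \<open>
  Write \<open>T\<close> for \<open>A\<^sub>n\<^sub>,\<^sub>m\<close> and \<open>T\<^sup>+\<close> for its pseudoinverse.  For \<open>u \<in> X\<^sub>n\<close> the vectors \<open>A u\<close> and \<open>T u\<close> differ by an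
  element orthogonal to the range of \<open>T\<close>, so \<open>T\<^sup>+ A u = T\<^sup>+ T u\<close> is the projection of \<open>u\<close> onto \<open>N(T)\<^sup>\<bottom>\<close>
  and has norm at most \<open>\<parallel>u\<parallel>\<close>; splitting \<open>x = u + (x - u)\<close> turns the approximation condition into
  a uniform bound, and the choice \<open>u = 0\<close> gives the converse.

  Given a uniform bound, it suffices to see that \<open>P\<^sub>n x - T\<^sup>+ T P\<^sub>n x\<close>, the projection of \<open>x\<close> onto
  \<open>X\<^sub>n \<inter> N(T)\<close>, tends to zero.  On the dense set of \<open>x = A\<^sup>* y\<close> in \<open>N(A)\<^sup>\<bottom>\<close> this holds because
  \<open>\<langle>A\<^sup>* y, v\<rangle> = \<langle>y - Q\<^sub>m y, A v\<rangle>\<close> for \<open>v \<in> X\<^sub>n \<inter> N(T)\<close>.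

  Conversely, joint convergence bounds the norms for \<open>n, m \<ge> N\<close> by the uniform boundedness
  principle.  For fixed \<open>n\<close> they are bounded in \<open>m\<close> since \<open>Q\<^sub>m \<rightarrow> I\<close> uniformly on the
  finite-dimensional range of \<open>A P\<^sub>n\<close>, and for fixed \<open>m\<close> they are bounded in \<open>n\<close> by the same argument
  for the adjoint.
\<close>

subsection \<open>Orthogonal projections and adjoints in Hilbert spaces\<close>

text \<open>Existence of the orthogonal decomposition is taken as the hypothesis, so that the
  projector facts below serve finite-dimensional subspaces of any inner product space as well as
  closed subspaces of a Hilbert space.\<close>

definition projectable :: "'a::real_inner set \<Rightarrow> bool" where
  "projectable S \<longleftrightarrow> subspace S \<and> (\<forall>x. \<exists>p\<in>S. x - p \<in> orthogonal_comp S)"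

lemma orthogonal_comp_iff: "x \<in> orthogonal_comp S \<longleftrightarrow> (\<forall>y\<in>S. y \<bullet> x = 0)"
  by (simp add: orthogonal_comp_def orthogonal_def)

lemma orth_projector_eqI:
  assumes "subspace S" "p \<in> S" "x - p \<in> orthogonal_comp S"
  shows "orth_projector S x = p"
  unfolding orth_projector_def
proof (rule the_equality)
  fix q assume q: "q \<in> S \<and> x - q \<in> orthogonal_comp S"
  have "q - p \<in> S" using assms q by (simp add: subspace_diff)
  then have "(q - p) \<bullet> (x - p) = 0" "(q - p) \<bullet> (x - q) = 0"
    using assms q by (auto simp: orthogonal_comp_iff)
  then have "(q - p) \<bullet> (q - p) = 0" by (simp add: inner_diff_right)
  then show "q = p" by simp
qed (use assms in auto)

context
  fixes S :: "'a::real_inner set"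
  assumes S: "projectable S"
begin

lemma projectable_subspace: "subspace S"
  using S by (simp add: projectable_def)

lemma orth_projector_props: "orth_projector S x \<in> S" "x - orth_projector S x \<in> orthogonal_comp S"
proof -
  obtain p where "p \<in> S" "x - p \<in> orthogonal_comp S" using S by (auto simp: projectable_def)
  moreover from this have "orth_projector S x = p"
    by (rule orth_projector_eqI[OF projectable_subspace])
  ultimately show "orth_projector S x \<in> S" "x - orth_projector S x \<in> orthogonal_comp S" by auto
qed

lemma orth_projector_residual: "y \<in> S \<Longrightarrow> y \<bullet> (x - orth_projector S x) = 0"
  using orth_projector_props(2) by (simp add: orthogonal_comp_iff)

lemma orth_projector_fixed: "x \<in> S \<Longrightarrow> orth_projector S x = x"
  by (rule orth_projector_eqI[OF projectable_subspace]) (auto simp: orthogonal_comp_iff)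

lemma orth_projector_selfadjoint: "orth_projector S x \<bullet> y = x \<bullet> orth_projector S y"
  using orth_projector_residual[OF orth_projector_props(1), of x y]
    orth_projector_residual[OF orth_projector_props(1), of y x]
  by (simp add: inner_diff_right inner_commute)

lemma norm_orth_projector_le: "norm (orth_projector S x) \<le> norm x"
proof -
  have "(norm (orth_projector S x))\<^sup>2 = x \<bullet> orth_projector S x"
    unfolding power2_norm_eq_inner
    using orth_projector_residual[OF orth_projector_props(1), of x x]
    by (simp add: inner_diff_right inner_commute)
  also have "\<dots> \<le> norm x * norm (orth_projector S x)" by (rule norm_cauchy_schwarz)
  finally show ?thesis by (cases "orth_projector S x = 0") (auto simp: power2_eq_square)
qed

lemma bounded_linear_orth_projector: "bounded_linear (orth_projector S)"
proof (rule bounded_linear_intro[where K=1])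
  note sub = projectable_subspace
  fix x y r
  show "orth_projector S (x + y) = orth_projector S x + orth_projector S y"
  proof (rule orth_projector_eqI[OF sub])
    show "orth_projector S x + orth_projector S y \<in> S"
      using orth_projector_props(1) sub by (simp add: subspace_add)
    have "x + y - (orth_projector S x + orth_projector S y)
        = (x - orth_projector S x) + (y - orth_projector S y)" by simp
    then show "x + y - (orth_projector S x + orth_projector S y) \<in> orthogonal_comp S"
      using orth_projector_props(2) subspace_orthogonal_comp by (metis subspace_add)
  qed
  show "orth_projector S (r *\<^sub>R x) = r *\<^sub>R orth_projector S x"
  proof (rule orth_projector_eqI[OF sub])
    show "r *\<^sub>R orth_projector S x \<in> S"
      using orth_projector_props(1) sub by (simp add: subspace_scale)
    show "r *\<^sub>R x - r *\<^sub>R orth_projector S x \<in> orthogonal_comp S"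
      using orth_projector_props(2) subspace_orthogonal_comp
      by (metis subspace_scale scaleR_diff_right)
  qed
  show "norm (orth_projector S x) \<le> norm x * 1" using norm_orth_projector_le by simp
qed

lemma orth_projector_closest:
  assumes "s \<in> S"
  shows "norm (x - orth_projector S x) \<le> norm (x - s)"
proof -
  have "orthogonal (x - orth_projector S x) (orth_projector S x - s)"
    using orth_projector_residual[of "orth_projector S x - s" x] assms
      orth_projector_props(1)[of x] projectable_subspace
    by (simp add: orthogonal_def inner_commute subspace_diff)
  then have "(norm (x - s))\<^sup>2 = (norm (x - orth_projector S x))\<^sup>2 + (norm (orth_projector S x - s))\<^sup>2"
    using norm_add_Pythagorean by fastforce
  then show ?thesis by (simp add: power2_le_imp_le)
qed

text \<open>The residual of a vector of the double complement is orthogonal both to the vector and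
  to its projection, hence to itself.\<close>

lemma projectable_double_comp: "orthogonal_comp (orthogonal_comp S) = S"
proof (intro equalityI orthogonal_comp_subset subsetI)
  fix x assume x: "x \<in> orthogonal_comp (orthogonal_comp S)"
  let ?r = "x - orth_projector S x"
  have "?r \<bullet> x = 0" using x orth_projector_props(2) by (simp add: orthogonal_comp_iff)
  moreover have "?r \<bullet> orth_projector S x = 0"
    using orth_projector_residual[OF orth_projector_props(1), of x x] by (simp add: inner_commute)
  ultimately have "?r \<bullet> ?r = 0" by (simp add: inner_diff_right)
  then have "x = orth_projector S x" by simp
  then show "x \<in> S" using orth_projector_props(1) by metis
qed

end

text \<open>Gram-Schmidt without normalisation. The explicit expansion reduces later statements
  about a finite-dimensional space (continuity of the pseudoinverse, uniform convergence of
  projectors) to finitely many vectors.\<close>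

lemma finite_dim_orthogonal_basis:
  fixes S :: "'a::real_inner set"
  assumes "finite_dim_subspace S"
  shows "\<exists>E. finite E \<and> E \<subseteq> S \<and> 0 \<notin> E \<and>
    (\<forall>x. x - (\<Sum>b\<in>E. (x \<bullet> b / (b \<bullet> b)) *\<^sub>R b) \<in> orthogonal_comp S) \<and>
    (\<forall>x\<in>S. (\<Sum>b\<in>E. (x \<bullet> b / (b \<bullet> b)) *\<^sub>R b) = x)"
proof -
  obtain B where B: "finite B" "span B = S" "subspace S"
    using assms by (auto simp: finite_dim_subspace_def)
  obtain C where C: "finite C" "span C = span B" "pairwise orthogonal C"
    using basis_orthogonal[OF B(1)] by auto
  \<comment> \<open>An orthogonal spanning set may contain 0; dropping it keeps the span and makes
    all divisors nonzero.\<close>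
  define E where "E = C - {0}"
  have E: "finite E" "span E = S" "pairwise orthogonal E" "0 \<notin> E"
    using C B by (auto simp: E_def span_delete_0 intro: pairwise_mono)
  define p where "p x = (\<Sum>b\<in>E. (x \<bullet> b / (b \<bullet> b)) *\<^sub>R b)" for x
  have "E \<subseteq> S" using E span_superset by auto
  have pS: "p x \<in> S" for x
    unfolding p_def using B(3) \<open>E \<subseteq> S\<close> by (intro subspace_sum subspace_scale) auto
  have orth: "x - p x \<in> orthogonal_comp S" for x
  proof -
    have "b \<bullet> (x - p x) = 0" if "b \<in> E" for b
    proof -
      have "b \<bullet> p x = (\<Sum>c\<in>E. (x \<bullet> c / (c \<bullet> c)) * (b \<bullet> c))"
        by (simp add: p_def inner_sum_right)
      also have "\<dots> = (\<Sum>c\<in>E. if c = b then x \<bullet> b else 0)"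
        using E that by (intro sum.cong) (auto simp: pairwise_def orthogonal_def)
      also have "\<dots> = x \<bullet> b" using E that by simp
      finally show ?thesis by (simp add: inner_diff_right inner_commute)
    qed
    then have "y \<bullet> (x - p x) = 0" if "y \<in> span E" for y
      using orthogonal_to_span[OF that, of "x - p x"]
      by (simp add: orthogonal_def inner_commute)
    then show ?thesis using E by (simp add: orthogonal_comp_iff)
  qed
  have "p x = x" if "x \<in> S" for x
  proof -
    have "x - p x \<in> S" using that pS B by (simp add: subspace_diff)
    then have "(x - p x) \<bullet> (x - p x) = 0" using orth by (auto simp: orthogonal_comp_iff)
    then show ?thesis by simp
  qed
  with \<open>E \<subseteq> S\<close> orth E(1,4) show ?thesis unfolding p_def by blast
qed

lemma projectable_finite_dim:
  assumes "finite_dim_subspace S"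
  shows "projectable S"
proof -
  obtain E where E: "finite E" "E \<subseteq> S"
    "\<And>x. x - (\<Sum>b\<in>E. (x \<bullet> b / (b \<bullet> b)) *\<^sub>R b) \<in> orthogonal_comp S"
    using finite_dim_orthogonal_basis[OF assms] by blast
  have S: "subspace S" using assms by (simp add: finite_dim_subspace_def)
  have "(\<Sum>b\<in>E. (x \<bullet> b / (b \<bullet> b)) *\<^sub>R b) \<in> S" for x
    using S E(2) by (intro subspace_sum subspace_scale) auto
  then show ?thesis using S E(3) unfolding projectable_def by blast
qed

text \<open>The classical argument: a minimising sequence for the distance is Cauchy by the
  parallelogram law, its limit attains the distance, and a minimiser has a residual orthogonal to
  the subspace.\<close>

lemma projectable_closed:
  fixes S :: "'a::{real_inner, complete_space} set"
  assumes S: "subspace S" "closed S"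
  shows "projectable S"
  unfolding projectable_def
proof (intro conjI allI)
  fix x
  have "S \<noteq> {}" using S(1) subspace_0 by auto
  define d where "d = infdist x S"
  have dle: "d \<le> norm (x - s)" if "s \<in> S" for s
    using infdist_le[OF that, of x] by (simp add: d_def dist_norm)
  have "d \<ge> 0" by (simp add: d_def infdist_nonneg)
  have "\<exists>s\<in>S. dist x s < d + e" if "e > 0" for e
    using cInf_lessD[of "dist x ` S" "d + e"] infdist_notempty[OF \<open>S \<noteq> {}\<close>, of x]
      \<open>S \<noteq> {}\<close> that unfolding d_def by auto
  then have "\<forall>k::nat. \<exists>s\<in>S. norm (x - s) < d + inverse (Suc k)"
    by (simp add: dist_norm)
  then obtain s where s: "\<And>k::nat. s k \<in> S" "\<And>k. norm (x - s k) < d + inverse (Suc k)"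
    by metis
  \<comment> \<open>The midpoint of \<open>s i\<close> and \<open>s j\<close> lies in
    \<open>S\<close>, so its distance to \<open>x\<close> is at least \<open>d\<close>; the
    parallelogram law then leaves little room for \<open>s i - s j\<close>.\<close>
  have gap: "(norm (s i - s j))\<^sup>2 \<le> 4 * (2 * d + 1) * inverse (Suc k)"
    if "k \<le> i" "k \<le> j" for i j k
  proof -
    let ?t = "inverse (real (Suc k))"
    have t: "0 < ?t" "?t \<le> 1" by (auto simp: divide_simps)
    have le: "norm (x - s i) \<le> d + ?t" "norm (x - s j) \<le> d + ?t"
      using s(2)[of i] s(2)[of j] that le_imp_inverse_le[of "real (Suc k)" "real (Suc i)"]
        le_imp_inverse_le[of "real (Suc k)" "real (Suc j)"] by linarith+
    have "(1/2) *\<^sub>R (s i + s j) \<in> S" using s S(1) by (simp add: subspace_add subspace_scale)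
    then have "d \<le> norm (x - (1/2) *\<^sub>R (s i + s j))" by (rule dle)
    also have "x - (1/2) *\<^sub>R (s i + s j) = (1/2) *\<^sub>R ((x - s i) + (x - s j))"
      by (simp add: algebra_simps scaleR_2[symmetric])
    finally have "2 * d \<le> norm ((x - s i) + (x - s j))" by simp
    then have "(2 * d)\<^sup>2 \<le> (norm ((x - s i) + (x - s j)))\<^sup>2"
      using \<open>d \<ge> 0\<close> by (intro power_mono) auto
    moreover have "(norm ((x - s i) + (x - s j)))\<^sup>2 + (norm (s i - s j))\<^sup>2
        = 2 * (norm (x - s i))\<^sup>2 + 2 * (norm (x - s j))\<^sup>2"
      by (simp add: power2_norm_eq_inner algebra_simps inner_commute)
    moreover have "(norm (x - s i))\<^sup>2 \<le> (d + ?t)\<^sup>2" "(norm (x - s j))\<^sup>2 \<le> (d + ?t)\<^sup>2"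
      using le by (auto intro!: power_mono)
    ultimately have "(norm (s i - s j))\<^sup>2 \<le> 4 * (d + ?t)\<^sup>2 - 4 * d\<^sup>2"
      by (simp add: power_mult_distrib)
    also have "\<dots> = 4 * (2 * d + ?t) * ?t" by (simp add: power2_eq_square algebra_simps)
    also have "\<dots> \<le> 4 * (2 * d + 1) * ?t" using t by (intro mult_right_mono) auto
    finally show ?thesis .
  qed
  have "Cauchy s"
  proof (rule CauchyI)
    fix e :: real assume "e > 0"
    have "(\<lambda>k. 4 * (2 * d + 1) * inverse (real (Suc k))) \<longlonglongrightarrow> 4 * (2 * d + 1) * 0"
      by (intro tendsto_intros LIMSEQ_inverse_real_of_nat)
    then have "\<forall>\<^sub>F k in sequentially. 4 * (2 * d + 1) * inverse (real (Suc k)) < e\<^sup>2"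
      using \<open>e > 0\<close> by (intro order_tendstoD(2)) auto
    then obtain k where "4 * (2 * d + 1) * inverse (real (Suc k)) < e\<^sup>2"
      by (auto simp: eventually_sequentially)
    then have "norm (s i - s j) < e" if "k \<le> i" "k \<le> j" for i j
      using gap[OF that] \<open>e > 0\<close> by (intro power2_less_imp_less[of _ e]) auto
    then show "\<exists>M. \<forall>m\<ge>M. \<forall>n\<ge>M. norm (s m - s n) < e" by blast
  qed
  then obtain p where p: "s \<longlonglongrightarrow> p" using Cauchy_convergent convergent_def by blast
  have pS: "p \<in> S" using S(2) s(1) p closed_sequentially by blast
  have "(\<lambda>k. norm (x - s k)) \<longlonglongrightarrow> norm (x - p)" by (intro tendsto_intros p)
  moreover have "(\<lambda>k. d + inverse (real (Suc k))) \<longlonglongrightarrow> d + 0"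
    by (intro tendsto_intros LIMSEQ_inverse_real_of_nat)
  ultimately have "norm (x - p) \<le> d + 0"
    by (rule LIMSEQ_le) (use s(2) less_imp_le in blast)
  then have min: "norm (x - p) \<le> norm (x - t)" if "t \<in> S" for t using dle[OF that] by simp
  have "y \<bullet> (x - p) = 0" if y: "y \<in> S" for y
  proof (cases "y = 0")
    case False
    \<comment> \<open>This \<open>c\<close> minimises the quadratic t -> |x - p - t y|^2; a nonzero
      inner product would push its value below the minimum.\<close>
    define c where "c = (y \<bullet> (x - p)) / (y \<bullet> y)"
    have "p + c *\<^sub>R y \<in> S" using pS y S(1) by (simp add: subspace_add subspace_scale)
    then have "(norm (x - p))\<^sup>2 \<le> (norm (x - (p + c *\<^sub>R y)))\<^sup>2"
      using min by (intro power_mono) auto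
    also have "\<dots> = (norm (x - p))\<^sup>2 - 2 * c * (y \<bullet> (x - p)) + c\<^sup>2 * (y \<bullet> y)"
      unfolding power2_norm_eq_inner
      by (simp add: algebra_simps inner_commute power2_eq_square)
    also have "\<dots> = (norm (x - p))\<^sup>2 - (y \<bullet> (x - p))\<^sup>2 / (y \<bullet> y)"
      using False by (simp add: c_def power2_eq_square field_simps)
    finally have "(y \<bullet> (x - p))\<^sup>2 / (y \<bullet> y) \<le> 0" by simp
    moreover have "0 < y \<bullet> y" using False by simp
    ultimately show ?thesis by (metis divide_pos_pos not_less zero_less_power2)
  qed simp
  with pS show "\<exists>p\<in>S. x - p \<in> orthogonal_comp S" by (auto simp: orthogonal_comp_iff)
qed (rule S)

section \<open>Nullspaces, Riesz representation and adjoints\<close>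

lemma subspace_nullspace: "linear T \<Longrightarrow> subspace (nullspace T)"
  unfolding nullspace_def by (rule linear_subspace_kernel)

lemma projectable_nullspace:
  fixes T :: "'a::{real_inner, complete_space} \<Rightarrow> 'b::real_normed_vector"
  assumes "bounded_linear T"
  shows "projectable (nullspace T)"
proof (rule projectable_closed)
  show "subspace (nullspace T)"
    using assms by (simp add: subspace_nullspace bounded_linear.linear)
  show "closed (nullspace T)" unfolding nullspace_def
    using assms by (intro closed_Collect_eq continuous_intros linear_continuous_on)
qed

text \<open>The kernel has codimension one: subtracting a suitable multiple of a vector
  \<open>w\<close> orthogonal to it moves any \<open>x\<close> into the kernel, which determines
  \<open>f x\<close> from the inner product with \<open>w\<close>.\<close>

lemma riesz_representation:
  fixes f :: "'a::{real_inner, complete_space} \<Rightarrow> real"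
  assumes "bounded_linear f"
  shows "\<exists>z. \<forall>x. f x = x \<bullet> z"
proof (cases "\<forall>x. f x = 0")
  case False
  interpret f: bounded_linear f by fact
  let ?N = "nullspace f"
  note N = projectable_nullspace[OF assms]
  obtain x0 where "f x0 \<noteq> 0" using False by auto
  define w where "w = x0 - orth_projector ?N x0"
  have "f (orth_projector ?N x0) = 0" using orth_projector_props(1)[OF N] by (simp add: nullspace_def)
  then have fw: "f w \<noteq> 0" using \<open>f x0 \<noteq> 0\<close> by (simp add: w_def f.diff)
  then have "w \<noteq> 0" by auto
  have "f x = x \<bullet> ((f w / (w \<bullet> w)) *\<^sub>R w)" for x
  proof -
    have "x - (f x / f w) *\<^sub>R w \<in> ?N" using fw by (simp add: nullspace_def f.diff f.scaleR)
    then have "(x - (f x / f w) *\<^sub>R w) \<bullet> w = 0"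
      unfolding w_def by (rule orth_projector_residual[OF N])
    then show ?thesis using fw \<open>w \<noteq> 0\<close> by (simp add: inner_diff_left field_simps)
  qed
  then show ?thesis by blast
qed (auto intro: exI[of _ 0])

text \<open>The function \<open>adjoint A\<close> is a choice that is meaningful only if some
  adjoint exists; Riesz representation of x -> \<langle>A x, y\<rangle> provides one for each
  \<open>y\<close>.\<close>

lemma hilbert_adjoint:
  fixes A :: "'a::{real_inner, complete_space} \<Rightarrow> 'b::real_inner"
  assumes "bounded_linear A"
  shows "A x \<bullet> y = x \<bullet> adjoint A y"
proof -
  have "\<exists>z. \<forall>x. A x \<bullet> y = x \<bullet> z" for y
    using bounded_linear_compose[OF bounded_linear_inner_left assms] by (rule riesz_representation)
  then obtain g where "\<forall>x y. A x \<bullet> y = x \<bullet> g y" by metis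
  then show ?thesis using adjoint_unique by metis
qed

lemma bounded_linear_hilbert_adjoint:
  fixes A :: "'a::{real_inner, complete_space} \<Rightarrow> 'b::real_inner"
  assumes A: "bounded_linear A"
  shows "bounded_linear (adjoint A)"
proof (rule bounded_linear_intro[where K = "onorm A"])
  note adj = hilbert_adjoint[OF A, symmetric]
  fix x y r
  show "adjoint A (x + y) = adjoint A x + adjoint A y"
    by (rule vector_eq_rdot[THEN iffD1]) (simp add: inner_add_left inner_add_right adj inner_commute[of _ "_::'a"])
  show "adjoint A (r *\<^sub>R x) = r *\<^sub>R adjoint A x"
    by (rule vector_eq_rdot[THEN iffD1]) (simp add: adj inner_commute[of _ "_::'a"])
  have "(norm (adjoint A x))\<^sup>2 = A (adjoint A x) \<bullet> x" by (simp add: power2_norm_eq_inner adj)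
  also have "\<dots> \<le> norm (A (adjoint A x)) * norm x" by (rule norm_cauchy_schwarz)
  also have "\<dots> \<le> onorm A * norm (adjoint A x) * norm x"
    using onorm[OF A] by (intro mult_right_mono) auto
  finally show "norm (adjoint A x) \<le> norm x * onorm A"
    using onorm_pos_le[OF A]
    by (cases "adjoint A x = 0") (auto simp: power2_eq_square mult_ac)
qed

lemma subspace_closure:
  fixes S :: "'a::real_normed_vector set"
  assumes "subspace S"
  shows "subspace (closure S)"
proof (rule subspaceI)
  show "0 \<in> closure S" using assms subspace_0 closure_subset by blast
  fix x y :: 'a and c :: real assume "x \<in> closure S" "y \<in> closure S"
  then obtain f g where f: "\<And>k. f k \<in> S" "f \<longlonglongrightarrow> x" and g: "\<And>k. g k \<in> S" "g \<longlonglongrightarrow> y"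
    unfolding closure_sequential by metis
  have "\<And>k. f k + g k \<in> S" "(\<lambda>k. f k + g k) \<longlonglongrightarrow> x + y"
    using assms f g by (auto intro: tendsto_add simp: subspace_add)
  then show "x + y \<in> closure S"
    unfolding closure_sequential by (intro exI[of _ "\<lambda>k. f k + g k"]) auto
  have "\<And>k. c *\<^sub>R f k \<in> S" "(\<lambda>k. c *\<^sub>R f k) \<longlonglongrightarrow> c *\<^sub>R x"
    using assms f by (auto intro: tendsto_intros simp: subspace_scale)
  then show "c *\<^sub>R x \<in> closure S"
    unfolding closure_sequential by (intro exI[of _ "\<lambda>k. c *\<^sub>R f k"]) auto
qed

text \<open>The residual r of \<open>x\<close> against the closed range of the adjoint satisfies
  \<langle>A r, y\<rangle> = \<langle>r, A* y\<rangle> = 0 for all y, so it lies in the nullspace of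
  \<open>A\<close> and is orthogonal to \<open>x\<close>. Being also orthogonal to the projection,
  it vanishes.\<close>

lemma range_adjoint_dense:
  fixes A :: "'a::{real_inner, complete_space} \<Rightarrow> 'b::real_inner"
  assumes A: "bounded_linear A" and x: "x \<in> orthogonal_comp (nullspace A)" and "e > 0"
  obtains y where "norm (x - adjoint A y) < e"
proof -
  let ?R = "closure (range (adjoint A))"
  have "subspace (range (adjoint A))"
    using bounded_linear.linear[OF bounded_linear_hilbert_adjoint[OF A]]
    by (simp add: linear_subspace_image)
  then have R: "projectable ?R"
    by (intro projectable_closed closed_closure) (rule subspace_closure)
  let ?r = "x - orth_projector ?R x"
  have "A ?r \<bullet> y = 0" for y
  proof -
    have "adjoint A y \<in> ?R" by (simp add: closure_subset[THEN subsetD])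
    then have "adjoint A y \<bullet> ?r = 0" by (rule orth_projector_residual[OF R])
    then show ?thesis using hilbert_adjoint[OF A, of ?r y] by (simp only: inner_commute)
  qed
  then have "A ?r = 0" by (metis inner_eq_zero_iff)
  then have "?r \<bullet> x = 0" using x by (simp add: orthogonal_comp_iff nullspace_def)
  moreover have "orth_projector ?R x \<bullet> ?r = 0"
    using orth_projector_residual[OF R orth_projector_props(1)[OF R]] .
  ultimately have "?r \<bullet> ?r = 0" by (metis inner_diff_right inner_commute diff_zero)
  then have "x = orth_projector ?R x" by simp
  then have "x \<in> ?R" using orth_projector_props(1)[OF R] by metis
  then obtain z where "z \<in> range (adjoint A)" "dist z x < e" using \<open>e > 0\<close> closure_approachable by metis
  then show ?thesis using that by (auto simp: dist_norm norm_minus_commute)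
qed

subsection \<open>Pseudoinverses of finite-rank operators\<close>

lemma finite_dim_subspace_image:
  assumes "linear T" "finite_dim_subspace S"
  shows "finite_dim_subspace (T ` S)"
proof -
  obtain B where B: "finite B" "span B = S" "subspace S"
    using assms(2) by (auto simp: finite_dim_subspace_def)
  have "span (T ` B) = T ` S" using linear_span_image[OF assms(1)] B by simp
  then show ?thesis
    unfolding finite_dim_subspace_def using B assms(1) linear_subspace_image by blast
qed

text \<open>Two orthogonality conditions certify the value. Pythagoras in the target space
  identifies the least-squares solutions with \<open>w\<close> plus the nullspace; Pythagoras in the
  domain makes \<open>w\<close> the unique shortest of them.\<close>

lemma pseudoinverse_eqI:
  assumes T: "linear T" and w: "w \<in> orthogonal_comp (nullspace T)"
    and res: "y - T w \<in> orthogonal_comp (range T)"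
  shows "pseudoinverse T y = w"
proof -
  interpret linear T by fact
  have split: "(norm (T z - y))\<^sup>2 = (norm (T w - y))\<^sup>2 + (norm (T (z - w)))\<^sup>2" for z
  proof -
    have "T (z - w) \<bullet> (y - T w) = 0" using res by (simp add: orthogonal_comp_iff)
    then have "orthogonal (T w - y) (T (z - w))"
      by (simp add: orthogonal_def inner_diff_left inner_diff_right inner_commute)
    then have "(norm ((T w - y) + T (z - w)))\<^sup>2 = (norm (T w - y))\<^sup>2 + (norm (T (z - w)))\<^sup>2"
      by (rule norm_add_Pythagorean)
    then show ?thesis by (simp add: diff)
  qed
  have lsq: "least_squares_solution T y z \<longleftrightarrow> T (z - w) = 0" for z
  proof
    assume "least_squares_solution T y z"
    then have "norm (T z - y) \<le> norm (T w - y)" by (simp add: least_squares_solution_def)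
    then have "(norm (T z - y))\<^sup>2 \<le> (norm (T w - y))\<^sup>2" by (intro power_mono) auto
    then show "T (z - w) = 0" using split[of z] by simp
  next
    assume "T (z - w) = 0"
    then have "(norm (T z - y))\<^sup>2 \<le> (norm (T x - y))\<^sup>2" for x
      using split[of z] split[of x] by simp
    then show "least_squares_solution T y z"
      unfolding least_squares_solution_def by (blast intro: power2_le_imp_le norm_ge_zero)
  qed
  have pyth: "(norm z)\<^sup>2 = (norm w)\<^sup>2 + (norm (z - w))\<^sup>2" if "T (z - w) = 0" for z
  proof -
    have "(z - w) \<bullet> w = 0" using w that by (simp add: orthogonal_comp_iff nullspace_def)
    then have "orthogonal w (z - w)" by (simp add: orthogonal_def inner_commute)
    from norm_add_Pythagorean[OF this] show ?thesis by simp
  qed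
  show ?thesis unfolding pseudoinverse_def
  proof (rule the_equality)
    have "norm w \<le> norm z" if "T (z - w) = 0" for z
      using pyth[OF that] by - (rule power2_le_imp_le[OF _ norm_ge_zero], simp)
    then show "least_squares_solution T y w \<and> (\<forall>z. least_squares_solution T y z \<longrightarrow> norm w \<le> norm z)"
      using lsq by (simp add: zero)
  next
    fix z
    assume z: "least_squares_solution T y z \<and> (\<forall>v. least_squares_solution T y v \<longrightarrow> norm z \<le> norm v)"
    then have "T (z - w) = 0" "norm z \<le> norm w" using lsq by (auto simp: zero)
    then have "(norm z)\<^sup>2 \<le> (norm w)\<^sup>2" by (intro power_mono) auto
    with pyth[OF \<open>T (z - w) = 0\<close>] show "z = w" by simp
  qed
qed

definition finite_rank :: "('a::real_normed_vector \<Rightarrow> 'b::real_normed_vector) \<Rightarrow> bool" where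
  "finite_rank T \<longleftrightarrow> bounded_linear T \<and> finite_dim_subspace (range T)"

context
  fixes T :: "'a::{real_inner, complete_space} \<Rightarrow> 'b::real_inner"
  assumes T: "finite_rank T"
begin

lemma finite_rank_bounded_linear: "bounded_linear T"
  using T by (simp add: finite_rank_def)

lemma finite_rank_linear: "linear T"
  by (rule bounded_linear.linear[OF finite_rank_bounded_linear])

lemma finite_rank_projectable: "projectable (nullspace T)" "projectable (range T)"
  using T projectable_nullspace projectable_finite_dim by (auto simp: finite_rank_def)

text \<open>Existence: project \<open>y\<close> onto the range, take any preimage, and remove its
  nullspace component.\<close>

lemma pseudoinverse_props:
  "pseudoinverse T y \<in> orthogonal_comp (nullspace T)"
  "y - T (pseudoinverse T y) \<in> orthogonal_comp (range T)"
proof -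
  note N = finite_rank_projectable(1)
  obtain x where x: "orth_projector (range T) y = T x"
    using orth_projector_props(1)[OF finite_rank_projectable(2), of y] by auto
  define w where "w = x - orth_projector (nullspace T) x"
  have "w \<in> orthogonal_comp (nullspace T)" using orth_projector_props(2)[OF N] by (simp add: w_def)
  moreover have "T w = T x"
    using orth_projector_props(1)[OF N, of x] finite_rank_linear
    by (simp add: w_def linear_diff nullspace_def)
  then have "y - T w \<in> orthogonal_comp (range T)"
    using orth_projector_props(2)[OF finite_rank_projectable(2), of y] x by simp
  moreover have "pseudoinverse T y = w" using finite_rank_linear calculation by (rule pseudoinverse_eqI)
  ultimately show "pseudoinverse T y \<in> orthogonal_comp (nullspace T)"
    "y - T (pseudoinverse T y) \<in> orthogonal_comp (range T)" by auto
qed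

text \<open>Expanding in an orthogonal basis of the range writes the pseudoinverse as a finite sum
  of bounded rank-one maps.\<close>

lemma bounded_linear_pseudoinverse: "bounded_linear (pseudoinverse T)"
proof -
  interpret T: bounded_linear T by (rule finite_rank_bounded_linear)
  have R: "finite_dim_subspace (range T)" using T by (simp add: finite_rank_def)
  obtain E where E: "finite E" "E \<subseteq> range T"
    "\<And>x. x - (\<Sum>b\<in>E. (x \<bullet> b / (b \<bullet> b)) *\<^sub>R b) \<in> orthogonal_comp (range T)"
    using finite_dim_orthogonal_basis[OF R] by blast
  let ?p = "pseudoinverse T"
  have Tp: "T (?p b) = b" if "b \<in> E" for b
  proof -
    have "b - T (?p b) \<in> range T"
      using E(2) that by (intro subspace_diff linear_subspace_image[OF finite_rank_linear]) auto
    then have "(b - T (?p b)) \<bullet> (b - T (?p b)) = 0"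
      using pseudoinverse_props(2)[of b] unfolding orthogonal_comp_iff by blast
    then show ?thesis by simp
  qed
  have "?p y = (\<Sum>b\<in>E. (y \<bullet> b / (b \<bullet> b)) *\<^sub>R ?p b)" for y
  proof (rule pseudoinverse_eqI[OF finite_rank_linear])
    show "(\<Sum>b\<in>E. (y \<bullet> b / (b \<bullet> b)) *\<^sub>R ?p b) \<in> orthogonal_comp (nullspace T)"
      by (intro subspace_sum subspace_scale subspace_orthogonal_comp pseudoinverse_props(1))
    have "T (\<Sum>b\<in>E. (y \<bullet> b / (b \<bullet> b)) *\<^sub>R ?p b) = (\<Sum>b\<in>E. (y \<bullet> b / (b \<bullet> b)) *\<^sub>R b)"
      by (simp add: T.sum T.scaleR Tp)
    then show "y - T (\<Sum>b\<in>E. (y \<bullet> b / (b \<bullet> b)) *\<^sub>R ?p b) \<in> orthogonal_comp (range T)"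
      using E(3) by simp
  qed
  then have "?p = (\<lambda>y. \<Sum>b\<in>E. (y \<bullet> b / (b \<bullet> b)) *\<^sub>R ?p b)" by blast
  moreover have "bounded_linear (\<lambda>y. \<Sum>b\<in>E. (y \<bullet> b / (b \<bullet> b)) *\<^sub>R ?p b)"
    by (intro bounded_linear_sum bounded_linear_scaleR_left[THEN bounded_linear_compose, unfolded o_def]
        bounded_linear_divide[THEN bounded_linear_compose, unfolded o_def] bounded_linear_inner_left)
  ultimately show ?thesis by simp
qed

lemma pseudoinverse_cancel: "w \<in> orthogonal_comp (nullspace T) \<Longrightarrow> pseudoinverse T (T w) = w"
  by (rule pseudoinverse_eqI[OF finite_rank_linear]) (auto simp: orthogonal_comp_iff)

lemma pseudoinverse_cong:
  assumes "y - z \<in> orthogonal_comp (range T)"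
  shows "pseudoinverse T y = pseudoinverse T z"
proof (rule pseudoinverse_eqI[OF finite_rank_linear pseudoinverse_props(1)])
  have "y - T (pseudoinverse T z) = (y - z) + (z - T (pseudoinverse T z))" by simp
  then show "y - T (pseudoinverse T z) \<in> orthogonal_comp (range T)"
    using assms pseudoinverse_props(2) subspace_orthogonal_comp by (metis subspace_add)
qed

lemma norm_apply_pseudoinverse_le: "norm (T (pseudoinverse T y)) \<le> norm y"
proof -
  have "orth_projector (range T) y = T (pseudoinverse T y)"
    using linear_subspace_image[OF finite_rank_linear subspace_UNIV] pseudoinverse_props(2)
    by (intro orth_projector_eqI) auto
  then show ?thesis using norm_orth_projector_le[OF finite_rank_projectable(2)] by metis
qed

lemma pseudoinverse_apply_nullspace: "u - pseudoinverse T (T u) \<in> nullspace T"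
proof -
  interpret T: bounded_linear T by (rule finite_rank_bounded_linear)
  have "T u - T (pseudoinverse T (T u)) = T (u - pseudoinverse T (T u))" by (simp add: T.diff)
  then have "(T u - T (pseudoinverse T (T u))) \<bullet> (T u - T (pseudoinverse T (T u))) = 0"
    using pseudoinverse_props(2)[of "T u"] unfolding orthogonal_comp_iff by (metis rangeI)
  then show ?thesis by (simp add: nullspace_def T.diff)
qed

text \<open>The map u -> \<open>pseudoinverse T (T u)\<close> is the orthogonal projection onto the
  complement of the nullspace.\<close>

lemma norm_pseudoinverse_apply_le: "norm (pseudoinverse T (T u)) \<le> norm u"
proof -
  have "(u - pseudoinverse T (T u)) \<bullet> pseudoinverse T (T u) = 0"
    using pseudoinverse_props(1) pseudoinverse_apply_nullspace by (simp add: orthogonal_comp_iff)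
  then have "orthogonal (pseudoinverse T (T u)) (u - pseudoinverse T (T u))"
    by (simp add: orthogonal_def inner_commute)
  from norm_add_Pythagorean[OF this] show ?thesis by - (rule power2_le_imp_le[OF _ norm_ge_zero], simp)
qed

end

text \<open>Transfers a bound from an operator to its adjoint. With w the value of the pseudoinverse
  of \<open>T\<close> at \<open>y\<close>, the residual of w against the range of \<open>S\<close>
  lies in the nullspace of \<open>T\<close>, to which w is orthogonal; hence |w|^2 = \<langle>T w,
  S^+ w\<rangle> \<le> |y| K |w|.\<close>

lemma norm_pseudoinverse_adjoint_le:
  fixes T :: "'a::{real_inner, complete_space} \<Rightarrow> 'b::{real_inner, complete_space}"
  assumes T: "finite_rank T" and S: "finite_rank S" and adj: "\<And>x y. T x \<bullet> y = x \<bullet> S y"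
    and "0 \<le> K" and K: "\<And>x. norm (pseudoinverse S x) \<le> K * norm x"
  shows "norm (pseudoinverse T y) \<le> K * norm y"
proof -
  define w where "w = pseudoinverse T y"
  have w: "w \<in> orthogonal_comp (nullspace T)" unfolding w_def by (rule pseudoinverse_props(1)[OF T])
  let ?r = "w - S (pseudoinverse S w)"
  have "T ?r \<bullet> z = 0" for z
    using pseudoinverse_props(2)[OF S, of w] unfolding adj orthogonal_comp_iff
    by (metis inner_commute rangeI)
  then have "?r \<in> nullspace T" unfolding nullspace_def by (metis inner_eq_zero_iff mem_Collect_eq)
  then have "?r \<bullet> w = 0" using w by (simp only: orthogonal_comp_iff)
  then have "w \<bullet> w = w \<bullet> S (pseudoinverse S w)"
    by (metis inner_diff_left inner_commute right_minus_eq)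
  then have "(norm w)\<^sup>2 = T w \<bullet> pseudoinverse S w" by (simp only: power2_norm_eq_inner adj)
  also have "\<dots> \<le> norm (T w) * norm (pseudoinverse S w)" by (rule norm_cauchy_schwarz)
  also have "\<dots> \<le> norm y * (K * norm w)"
    using norm_apply_pseudoinverse_le[OF T, of y] K[of w] by (intro mult_mono) (auto simp: w_def)
  finally have "norm w * norm w \<le> (K * norm y) * norm w" by (simp add: power2_eq_square mult_ac)
  then show ?thesis using \<open>0 \<le> K\<close> unfolding w_def[symmetric] by (cases "w = 0") auto
qed

subsection \<open>Uniform bounds along one index\<close>

lemma bounded_linear_uniform_boundedness:
  fixes f :: "nat \<Rightarrow> 'a::{real_normed_vector, complete_space} \<Rightarrow> 'b::real_normed_vector"
  assumes f: "\<And>k. bounded_linear (f k)" and ptw: "\<And>x. bounded (range (\<lambda>k. f k x))"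
  shows "\<exists>K. \<forall>k. onorm (f k) \<le> K"
proof -
  define F where "F j = {x. \<forall>k. norm (f k x) \<le> real j}" for j :: nat
  have "closed (F j)" for j
    unfolding F_def by (intro closed_Collect_all closed_Collect_le continuous_intros
        linear_continuous_on[OF f])
  moreover have "\<Union>(range F) = UNIV"
  proof -
    have "\<exists>j. x \<in> F j" for x
    proof -
      obtain B where "\<And>k. norm (f k x) \<le> B" using ptw[of x] by (auto simp: bounded_iff)
      moreover obtain j :: nat where "B \<le> real j" using real_arch_simple by blast
      ultimately show ?thesis unfolding F_def using order_trans by blast
    qed
    then show ?thesis by auto
  qed
  \<comment> \<open>Baire: if every closed set \<open>F j\<close> had empty interior, so would their
    union, which is the whole space.\<close>
  moreover have "(euclidean :: 'a topology) interior_of \<Union>(range F) = {}"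
    if "\<And>j. interior (F j) = {}"
    using that \<open>\<And>j. closed (F j)\<close>
    by (intro Baire_category_alt) (auto simp: completely_metrizable_space_euclidean)
  ultimately obtain j where "interior (F j) \<noteq> {}" by fastforce
  then obtain a where "a \<in> interior (F j)" by auto
  then obtain r where r: "r > 0" "cball a r \<subseteq> F j" by (auto simp: mem_interior_cball)
  have "norm (f k x) \<le> (2 * real j / r) * norm x" for k x
  proof (cases "x = 0")
    case False
    interpret bounded_linear "f k" by (rule f)
    \<comment> \<open>Rescaled to length \<open>r\<close>, the vector is a difference of two points
      of the ball, at each of which every \<open>f k\<close> is bounded by \<open>j\<close>.\<close>
    let ?h = "(r / norm x) *\<^sub>R x"
    have "a + ?h \<in> F j" "a \<in> F j" using r False by (auto simp: dist_norm subset_iff)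
    then have "norm (f k (a + ?h)) \<le> j" "norm (f k a) \<le> j" by (auto simp: F_def)
    moreover have "f k ?h = f k (a + ?h) - f k a" by (simp add: add)
    ultimately have "norm (f k ?h) \<le> 2 * real j" 
      using norm_triangle_ineq4[of "f k (a + ?h)" "f k a"] by simp
    then show ?thesis using r False by (simp add: scaleR field_simps)
  qed (simp add: bounded_linear.linear[OF f, THEN linear_0])
  then have "onorm (f k) \<le> 2 * real j / r" for k using r by (intro onorm_bound) auto
  then show ?thesis by blast
qed

section \<open>Convergence of the projectors along approximating subspaces\<close>

lemma approximating_subspaces_finite_dim: "approximating_subspaces X \<Longrightarrow> finite_dim_subspace (X n)"
  by (simp add: approximating_subspaces_def)

lemma approximating_subspaces_projectable: "approximating_subspaces X \<Longrightarrow> projectable (X n)"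
  by (intro projectable_finite_dim approximating_subspaces_finite_dim)

lemma orth_projector_tendsto:
  assumes X: "approximating_subspaces X"
  shows "(\<lambda>n. orth_projector (X n) x) \<longlonglongrightarrow> x"
proof (rule LIMSEQ_I)
  fix e :: real assume "e > 0"
  have "x \<in> closure (\<Union>n. X n)" using X by (simp add: approximating_subspaces_def)
  then obtain s N where s: "s \<in> X N" "dist s x < e" using \<open>e > 0\<close> closure_approachable by blast
  have "norm (orth_projector (X n) x - x) < e" if "N \<le> n" for n
  proof -
    have "X N \<subseteq> X n" using X that
      by (intro lift_Suc_mono_le[of X N n]) (auto simp: approximating_subspaces_def)
    then have "norm (x - orth_projector (X n) x) \<le> norm (x - s)"
      using s by (intro orth_projector_closest approximating_subspaces_projectable[OF X]) auto
    then show ?thesis using s(2) by (simp add: dist_norm norm_minus_commute)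
  qed
  then show "\<exists>N. \<forall>n\<ge>N. norm (orth_projector (X n) x - x) < e" by blast
qed

lemma orth_projector_tendsto_uniform:
  assumes Y: "approximating_subspaces Y" and R: "finite_dim_subspace R" and "e > 0"
  shows "\<forall>\<^sub>F m in sequentially. \<forall>r\<in>R. norm (r - orth_projector (Y m) r) \<le> e * norm r"
proof -
  obtain E where E: "finite E" "0 \<notin> E" "\<And>x. x \<in> R \<Longrightarrow> (\<Sum>b\<in>E. (x \<bullet> b / (b \<bullet> b)) *\<^sub>R b) = x"
    using finite_dim_orthogonal_basis[OF R] by blast
  \<comment> \<open>By Cauchy-Schwarz the coefficient of \<open>r\<close> at \<open>b\<close> is at
    most |r| / |b|, so this sum bounds the relative projection error for every \<open>r\<close> in
    \<open>R\<close> simultaneously.\<close>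
  let ?d = "\<lambda>m. \<Sum>b\<in>E. norm (b - orth_projector (Y m) b) / norm b"
  have "?d \<longlonglongrightarrow> (\<Sum>b\<in>E. norm (b - b) / norm b)"
    using E(2) by (intro tendsto_intros orth_projector_tendsto[OF Y]) auto
  then have "\<forall>\<^sub>F m in sequentially. ?d m < e"
    using \<open>e > 0\<close> by (intro order_tendstoD(2)) auto
  then show ?thesis
  proof (rule eventually_mono, intro ballI)
    fix m r assume m: "?d m < e" and r: "r \<in> R"
    interpret Q: bounded_linear "orth_projector (Y m)"
      by (intro bounded_linear_orth_projector approximating_subspaces_projectable[OF Y])
    have Qr: "orth_projector (Y m) r = (\<Sum>b\<in>E. (r \<bullet> b / (b \<bullet> b)) *\<^sub>R orth_projector (Y m) b)"
      using arg_cong[OF E(3)[OF r], of "orth_projector (Y m)"] by (simp add: Q.sum Q.scaleR)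
    have "r - orth_projector (Y m) r = (\<Sum>b\<in>E. (r \<bullet> b / (b \<bullet> b)) *\<^sub>R (b - orth_projector (Y m) b))"
      using E(3)[OF r] Qr by (simp add: scaleR_diff_right sum_subtractf)
    also have "norm \<dots> \<le> (\<Sum>b\<in>E. norm r * (norm (b - orth_projector (Y m) b) / norm b))"
    proof (rule sum_norm_le)
      fix b assume "b \<in> E"
      then have "b \<noteq> 0" using E(2) by auto
      have "\<bar>r \<bullet> b\<bar> / (b \<bullet> b) \<le> (norm r * norm b) / (b \<bullet> b)"
        by (intro divide_right_mono Cauchy_Schwarz_ineq2) auto
      also have "\<dots> = norm r / norm b"
        using \<open>b \<noteq> 0\<close> by (simp add: power2_norm_eq_inner[symmetric] power2_eq_square)
      finally have "norm ((r \<bullet> b / (b \<bullet> b)) *\<^sub>R (b - orth_projector (Y m) b))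
          \<le> norm r / norm b * norm (b - orth_projector (Y m) b)"
        unfolding norm_scaleR real_norm_def abs_divide abs_of_nonneg[OF inner_ge_zero]
        by (rule mult_right_mono) simp
      then show "norm ((r \<bullet> b / (b \<bullet> b)) *\<^sub>R (b - orth_projector (Y m) b))
          \<le> norm r * (norm (b - orth_projector (Y m) b) / norm b)" by simp
    qed
    also have "\<dots> = norm r * ?d m" by (simp add: sum_distrib_left)
    also have "\<dots> \<le> norm r * e" using m by (intro mult_left_mono) auto
    finally show "norm (r - orth_projector (Y m) r) \<le> e * norm r" by (simp add: mult.commute)
  qed
qed

lemma finite_rank_comp_orth_projector:
  assumes "bounded_linear A" "finite_dim_subspace V"
  shows "finite_rank (A \<circ> orth_projector V)"
proof -
  note V = projectable_finite_dim[OF assms(2)]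
  have "range (orth_projector V) = V"
  proof
    show "V \<subseteq> range (orth_projector V)" using orth_projector_fixed[OF V] by (metis rangeI subsetI)
  qed (use orth_projector_props(1)[OF V] in auto)
  then have "range (A \<circ> orth_projector V) = A ` V" by (simp only: image_comp[symmetric])
  then show ?thesis
    using assms finite_dim_subspace_image[OF bounded_linear.linear[OF assms(1)]]
      bounded_linear_compose[OF assms(1) bounded_linear_orth_projector[OF V]]
    by (simp add: finite_rank_def o_def)
qed

lemma finite_rank_projected:
  assumes "bounded_linear A" "finite_dim_subspace V" "finite_dim_subspace W"
  shows "finite_rank (orth_projector W \<circ> A \<circ> orth_projector V)"
  using bounded_linear_compose[OF bounded_linear_orth_projector assms(1)] assms
  by (intro finite_rank_comp_orth_projector) (simp_all add: o_def projectable_finite_dim)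

lemma eventually_bound_imp_bound:
  fixes g :: "nat \<Rightarrow> real"
  assumes "\<forall>\<^sub>F m in sequentially. g m \<le> K"
  shows "\<exists>L\<ge>0. \<forall>m. g m \<le> L"
proof -
  obtain N where N: "\<And>m. N \<le> m \<Longrightarrow> g m \<le> K" using assms by (auto simp: eventually_sequentially)
  have "g m \<le> \<bar>K\<bar> + (\<Sum>k<N. \<bar>g k\<bar>)" for m
  proof (cases "N \<le> m")
    case True
    have "0 \<le> (\<Sum>k<N. \<bar>g k\<bar>)" by (intro sum_nonneg) auto
    then show ?thesis using N[OF True] by linarith
  next
    case False
    then have "\<bar>g m\<bar> \<le> (\<Sum>k<N. \<bar>g k\<bar>)" by (intro member_le_sum) auto
    then show ?thesis by simp
  qed
  moreover have "0 \<le> \<bar>K\<bar> + (\<Sum>k<N. \<bar>g k\<bar>)" by (intro add_nonneg_nonneg sum_nonneg) auto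
  ultimately show ?thesis by blast
qed

text \<open>For large m the projector onto \<open>Y m\<close> shrinks vectors in the range of T = A
  P by at most the factor 1/2, so |T w| \<le> 2 |T_m w|, and the pseudoinverse of T_m is bounded by
  twice that of T. The finitely many remaining m have individual bounds.\<close>

lemma pseudoinverse_bounded_range_refinement:
  fixes A :: "'a::{real_inner, complete_space} \<Rightarrow> 'b::real_inner"
  assumes A: "bounded_linear A" and V: "finite_dim_subspace V" and Y: "approximating_subspaces Y"
  shows "\<exists>K\<ge>0. \<forall>m y.
    norm (pseudoinverse (orth_projector (Y m) \<circ> A \<circ> orth_projector V) y) \<le> K * norm y"
proof -
  define T where "T = A \<circ> orth_projector V"
  have T: "finite_rank T" unfolding T_def by (rule finite_rank_comp_orth_projector[OF A V])
  define Tm where "Tm m = orth_projector (Y m) \<circ> A \<circ> orth_projector V" for m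
  have TmT: "Tm m x = orth_projector (Y m) (T x)" for m x by (simp add: Tm_def T_def)
  have Tm: "finite_rank (Tm m)" for m
    unfolding Tm_def by (intro finite_rank_projected A V approximating_subspaces_finite_dim[OF Y])
  have pT: "bounded_linear (pseudoinverse T)" by (rule bounded_linear_pseudoinverse[OF T])
  define K where "K = onorm (pseudoinverse T)"
  have "0 \<le> K" unfolding K_def by (rule onorm_pos_le[OF pT])
  have "\<forall>\<^sub>F m in sequentially. \<forall>r\<in>range T. norm (r - orth_projector (Y m) r) \<le> 1/2 * norm r"
    using T by (intro orth_projector_tendsto_uniform[OF Y]) (auto simp: finite_rank_def)
  then have "\<forall>\<^sub>F m in sequentially. onorm (pseudoinverse (Tm m)) \<le> 2 * K"
  proof (rule eventually_mono)
    fix m assume m: "\<forall>r\<in>range T. norm (r - orth_projector (Y m) r) \<le> 1/2 * norm r"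
    show "onorm (pseudoinverse (Tm m)) \<le> 2 * K"
    proof (rule onorm_bound)
      fix y
      let ?w = "pseudoinverse (Tm m) y"
      have "orth_projector (Y m) 0 = 0"
        by (intro linear_0 bounded_linear.linear bounded_linear_orth_projector
            approximating_subspaces_projectable[OF Y])
      \<comment> \<open>Complements reverse this inclusion, so \<open>?w\<close> is orthogonal to
        the nullspace of \<open>T\<close> and is recovered from \<open>T ?w\<close> by the
        pseudoinverse of \<open>T\<close>.\<close>
      then have "nullspace T \<subseteq> nullspace (Tm m)" by (auto simp: nullspace_def TmT)
      then have "?w \<in> orthogonal_comp (nullspace T)"
        using pseudoinverse_props(1)[OF Tm] orthogonal_comp_anti_mono by blast
      then have "?w = pseudoinverse T (T ?w)" by (rule pseudoinverse_cancel[OF T, symmetric])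
      then have "norm ?w \<le> K * norm (T ?w)" using onorm[OF pT] unfolding K_def by metis
      moreover have "norm (T ?w - orth_projector (Y m) (T ?w)) \<le> 1/2 * norm (T ?w)" using m by blast
      then have "norm (T ?w) \<le> 2 * norm (Tm m ?w)"
        using norm_triangle_sub[of "T ?w" "Tm m ?w"] by (simp add: TmT)
      then have "norm (T ?w) \<le> 2 * norm y" using norm_apply_pseudoinverse_le[OF Tm, of m y] by simp
      then have "K * norm (T ?w) \<le> K * (2 * norm y)" using \<open>0 \<le> K\<close> by (rule mult_left_mono)
      ultimately show "norm ?w \<le> 2 * K * norm y" by simp
    qed (use \<open>0 \<le> K\<close> in simp)
  qed
  then obtain L where L: "0 \<le> L" "\<And>m. onorm (pseudoinverse (Tm m)) \<le> L"
    using eventually_bound_imp_bound[of "\<lambda>m. onorm (pseudoinverse (Tm m))" "2 * K"] by blast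
  have "norm (pseudoinverse (Tm m) y) \<le> L * norm y" for m y
    using onorm[OF bounded_linear_pseudoinverse[OF Tm], of m y]
      mult_right_mono[OF L(2)[of m] norm_ge_zero[of y]] by linarith
  with L(1) show ?thesis unfolding Tm_def by blast
qed

text \<open>The adjoint of Q A P_n is P_n A* Q, where the refined space is on the range side; the
  previous bound applies there and passes back to the adjoint with the same constant.\<close>

lemma pseudoinverse_bounded_domain_refinement:
  fixes A :: "'a::{real_inner, complete_space} \<Rightarrow> 'b::{real_inner, complete_space}"
  assumes A: "bounded_linear A" and W: "finite_dim_subspace W" and X: "approximating_subspaces X"
  shows "\<exists>K\<ge>0. \<forall>n y.
    norm (pseudoinverse (orth_projector W \<circ> A \<circ> orth_projector (X n)) y) \<le> K * norm y"
proof -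
  note adj = bounded_linear_hilbert_adjoint[OF A]
  obtain K where K: "0 \<le> K"
    "\<And>n y. norm (pseudoinverse (orth_projector (X n) \<circ> adjoint A \<circ> orth_projector W) y) \<le> K * norm y"
    using pseudoinverse_bounded_range_refinement[OF adj W X] by blast
  note Xn = approximating_subspaces_finite_dim[OF X]
  have "norm (pseudoinverse (orth_projector W \<circ> A \<circ> orth_projector (X n)) y) \<le> K * norm y" for n y
  proof (rule norm_pseudoinverse_adjoint_le[OF _ _ _ K])
    show "finite_rank (orth_projector W \<circ> A \<circ> orth_projector (X n))"
      by (rule finite_rank_projected[OF A Xn W])
    show "finite_rank (orth_projector (X n) \<circ> adjoint A \<circ> orth_projector W)"
      by (rule finite_rank_projected[OF adj W Xn])
    show "(orth_projector W \<circ> A \<circ> orth_projector (X n)) x \<bullet> y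
        = x \<bullet> (orth_projector (X n) \<circ> adjoint A \<circ> orth_projector W) y" for x y
      by (simp add: orth_projector_selfadjoint projectable_finite_dim W Xn hilbert_adjoint[OF A])
  qed
  with K(1) show ?thesis by blast
qed

text \<open>A pair outside the quadrant n, m \<ge> N lies in one of finitely many rows or
  columns.\<close>

lemma uniform_bound_product:
  fixes g :: "nat \<Rightarrow> nat \<Rightarrow> real"
  assumes tail: "\<And>n m. N \<le> n \<Longrightarrow> N \<le> m \<Longrightarrow> g n m \<le> K"
    and rows: "\<And>n. \<exists>L. \<forall>m. g n m \<le> L" and cols: "\<And>m. \<exists>L. \<forall>n. g n m \<le> L"
  shows "\<exists>L. \<forall>n m. g n m \<le> L"
proof -
  obtain a b where a: "\<And>n m. g n m \<le> a n" and b: "\<And>m n. g n m \<le> b m" using rows cols by metis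
  have "g n m \<le> Max (insert K (a ` {..<N} \<union> b ` {..<N}))" for n m
  proof -
    have "\<exists>c\<in>insert K (a ` {..<N} \<union> b ` {..<N}). g n m \<le> c"
      using tail[of n m] a[of n m] b[of n m] by (cases "n < N"; cases "m < N") auto
    then show ?thesis by (subst Max_ge_iff) auto
  qed
  then show ?thesis by blast
qed

subsection \<open>Boundedness and convergence\<close>

lemma norm_pseudoinverse_comp_le:
  fixes A :: "'a::{real_inner, complete_space} \<Rightarrow> 'b::real_inner" and T :: "'a \<Rightarrow> 'b"
  assumes T: "finite_rank T" and A: "linear A"
    and compat: "A u - T u \<in> orthogonal_comp (range T)"
    and C: "norm (x - u) + norm (pseudoinverse T (A (x - u))) \<le> C * norm x"
  shows "norm (pseudoinverse T (A x)) \<le> (1 + C) * norm x"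
proof -
  interpret p: bounded_linear "pseudoinverse T" by (rule bounded_linear_pseudoinverse[OF T])
  have "pseudoinverse T (A x) = pseudoinverse T (T u) + pseudoinverse T (A (x - u))"
    using pseudoinverse_cong[OF T compat] by (simp add: linear_diff[OF A] p.diff)
  then have "norm (pseudoinverse T (A x)) \<le> norm u + norm (pseudoinverse T (A (x - u)))"
    using norm_triangle_ineq[of "pseudoinverse T (T u)" "pseudoinverse T (A (x - u))"]
      norm_pseudoinverse_apply_le[OF T, of u] by simp
  \<comment> \<open>The second summand here is paid for by the first summand of \<open>C\<close>;
    the extra 1 in the constant is the cost of \<open>norm x\<close>.\<close>
  also have "norm u \<le> norm x + norm (x - u)" by (metis norm_triangle_sub norm_minus_commute)
  finally show ?thesis using C by (simp add: algebra_simps)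
qed

text \<open>Isolates the error estimate shared by the fully discrete and the semidiscrete case. The
  number \<open>d\<close> measures how far \<open>x\<close> is from being orthogonal to the part of
  \<open>V\<close> killed by \<open>T\<close>; the error is the operator's action on the residual of
  \<open>x\<close>, the residual itself, and one vector \<open>v\<close> of that part, whose norm is
  at most \<open>d\<close>.\<close>

lemma pseudoinverse_comp_error:
  fixes A :: "'a::{real_inner, complete_space} \<Rightarrow> 'b::real_inner" and T :: "'a \<Rightarrow> 'b"
  assumes T: "finite_rank T" and A: "linear A" and V: "projectable V"
    and null: "orthogonal_comp V \<subseteq> nullspace T"
    and compat: "\<And>u. u \<in> V \<Longrightarrow> A u - T u \<in> orthogonal_comp (range T)"
    and M: "\<And>z. norm (pseudoinverse T (A z)) \<le> M * norm z"
    and d: "0 \<le> d" "\<And>v. v \<in> V \<Longrightarrow> v \<in> nullspace T \<Longrightarrow> x \<bullet> v \<le> d * norm v"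
  shows "norm (pseudoinverse T (A x) - x) \<le> (M + 1) * norm (x - orth_projector V x) + d"
proof -
  interpret p: bounded_linear "pseudoinverse T" by (rule bounded_linear_pseudoinverse[OF T])
  let ?P = "orth_projector V x"
  define w where "w = pseudoinverse T (T ?P)"
  define v where "v = ?P - w"
  have PV: "?P \<in> V" by (rule orth_projector_props(1)[OF V])
  have "w \<in> orthogonal_comp (nullspace T)" unfolding w_def by (rule pseudoinverse_props(1)[OF T])
  moreover have "v \<in> nullspace T"
    unfolding v_def w_def by (rule pseudoinverse_apply_nullspace[OF T])
  ultimately have vw: "v \<bullet> w = 0" by (simp add: orthogonal_comp_iff)
  \<comment> \<open>Taking complements in \<open>null\<close> puts the complement of the nullspace
    inside the double complement of \<open>V\<close>, which is \<open>V\<close>.\<close>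
  have "w \<in> V"
    using orthogonal_comp_anti_mono[OF null] \<open>w \<in> orthogonal_comp (nullspace T)\<close>
      projectable_double_comp[OF V] by blast
  then have "v \<in> V" using PV projectable_subspace[OF V] by (simp add: v_def subspace_diff)
  have "v \<bullet> v = v \<bullet> ?P" using vw by (metis v_def inner_diff_right diff_zero)
  also have "\<dots> = x \<bullet> v"
    using orth_projector_residual[OF V \<open>v \<in> V\<close>, of x] by (simp add: inner_diff_right inner_commute)
  also have "\<dots> \<le> d * norm v" by (rule d) fact+
  finally have "norm v * norm v \<le> d * norm v" by (simp add: power2_norm_eq_inner[symmetric] power2_eq_square)
  then have "norm v \<le> d" using d(1) by (cases "v = 0") auto
  have "pseudoinverse T (A ?P) = w"
    unfolding w_def by (rule pseudoinverse_cong[OF T compat[OF PV]])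
  then have "pseudoinverse T (A x) - x = pseudoinverse T (A (x - ?P)) - (x - ?P) - v"
    by (simp add: linear_diff[OF A] p.diff v_def)
  also have "norm \<dots> \<le> norm (pseudoinverse T (A (x - ?P))) + norm (x - ?P) + norm v"
    using norm_triangle_ineq4[of "pseudoinverse T (A (x - ?P)) - (x - ?P)" v]
      norm_triangle_ineq4[of "pseudoinverse T (A (x - ?P))" "x - ?P"] by linarith
  also have "\<dots> \<le> M * norm (x - ?P) + norm (x - ?P) + d"
    using M[of "x - ?P"] \<open>norm v \<le> d\<close> by linarith
  finally show ?thesis by (simp add: algebra_simps)
qed

lemma bdd_above_onorm_iff:
  fixes f :: "'i \<Rightarrow> 'a::real_normed_vector \<Rightarrow> 'b::real_normed_vector"
  assumes f: "\<And>i. bounded_linear (f i)"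
  shows "bdd_above (range (\<lambda>i. onorm (f i))) \<longleftrightarrow> (\<exists>M. \<forall>i x. norm (f i x) \<le> M * norm x)"
proof
  assume "bdd_above (range (\<lambda>i. onorm (f i)))"
  then obtain M where M: "\<And>i. onorm (f i) \<le> M" by (auto simp: bdd_above_def)
  have "norm (f i x) \<le> M * norm x" for i x
    using onorm[OF f, of i x] mult_right_mono[OF M[of i] norm_ge_zero[of x]] by linarith
  then show "\<exists>M. \<forall>i x. norm (f i x) \<le> M * norm x" by blast
next
  assume "\<exists>M. \<forall>i x. norm (f i x) \<le> M * norm x"
  then obtain M where M: "\<And>i x. norm (f i x) \<le> M * norm x" by blast
  \<comment> \<open>The absolute value guards against a negative \<open>M\<close>, which is possible
    on a trivial space.\<close>
  have "onorm (f i) \<le> \<bar>M\<bar>" for i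
  proof (rule onorm_bound)
    show "norm (f i x) \<le> \<bar>M\<bar> * norm x" for x
      using M[of i x] mult_right_mono[OF abs_ge_self[of M] norm_ge_zero[of x]] by linarith
  qed simp
  then show "bdd_above (range (\<lambda>i. onorm (f i)))" by (auto simp: bdd_above_def)
qed

section \<open>The doubly indexed operators: bound, approximation and joint convergence\<close>

context
  fixes A :: "'a::{real_inner, complete_space} \<Rightarrow> 'b::{real_inner, complete_space}"
    and X :: "nat \<Rightarrow> 'a set" and Y :: "nat \<Rightarrow> 'b set"
  assumes A: "bounded_linear A" and X: "approximating_subspaces X" and Y: "approximating_subspaces Y"
begin

lemma finite_rank_projected_operator: "finite_rank (projected_operator A X Y n m)"
  unfolding projected_operator_def
  by (intro finite_rank_projected A approximating_subspaces_finite_dim[OF X]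
      approximating_subspaces_finite_dim[OF Y])

lemma bounded_linear_pseudoinverse_comp: "bounded_linear (\<lambda>x. pseudoinverse (projected_operator A X Y n m) (A x))"
  by (rule bounded_linear_compose[OF bounded_linear_pseudoinverse[OF finite_rank_projected_operator] A])

text \<open>On \<open>X n\<close> the operator is Q_m A, so the difference is the residual of
  \<open>A u\<close> against \<open>Y m\<close>, and \<open>Y m\<close> contains the range.\<close>

lemma projected_operator_compat:
  assumes "u \<in> X n"
  shows "A u - projected_operator A X Y n m u \<in> orthogonal_comp (range (projected_operator A X Y n m))"
proof -
  note Yp = approximating_subspaces_projectable[OF Y]
  have "projected_operator A X Y n m u = orth_projector (Y m) (A u)"
    using orth_projector_fixed[OF approximating_subspaces_projectable[OF X] assms]
    by (simp add: projected_operator_def)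
  moreover have "range (projected_operator A X Y n m) \<subseteq> Y m"
    using orth_projector_props(1)[OF Yp] by (auto simp: projected_operator_def)
  ultimately show ?thesis
    using orth_projector_props(2)[OF Yp, of "A u" m]
      orthogonal_comp_anti_mono[of "range (projected_operator A X Y n m)" "Y m"] by auto
qed

lemma onorm_bdd_iff:
  "bdd_above (range (\<lambda>(n, m). onorm (pseudoinverse (projected_operator A X Y n m) \<circ> A)))
    \<longleftrightarrow> (\<exists>M. \<forall>n m x. norm (pseudoinverse (projected_operator A X Y n m) (A x)) \<le> M * norm x)"
  \<comment> \<open>The pair (n, m) serves as a single index.\<close>
  using bdd_above_onorm_iff[of "\<lambda>i x. pseudoinverse (projected_operator A X Y (fst i) (snd i)) (A x)"]
    bounded_linear_pseudoinverse_comp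
  by (simp add: case_prod_unfold o_def)

lemma bound_iff_approximation:
  "(\<exists>M. \<forall>n m x. norm (pseudoinverse (projected_operator A X Y n m) (A x)) \<le> M * norm x)
    \<longleftrightarrow> (\<exists>C::real. \<forall>x n m. \<exists>u\<in>X n.
           norm (x - u) + norm (pseudoinverse (projected_operator A X Y n m) (A (x - u))) \<le> C * norm x)"
proof
  assume "\<exists>M. \<forall>n m x. norm (pseudoinverse (projected_operator A X Y n m) (A x)) \<le> M * norm x"
  then obtain M where M: "\<And>n m x. norm (pseudoinverse (projected_operator A X Y n m) (A x)) \<le> M * norm x" by blast
  have "0 \<in> X n" for n
    by (intro subspace_0 projectable_subspace approximating_subspaces_projectable[OF X])
  moreover have "norm (x - 0) + norm (pseudoinverse (projected_operator A X Y n m) (A (x - 0))) \<le> (1 + M) * norm x" for x n m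
    using M[of n m x] by (simp add: algebra_simps)
  ultimately show "\<exists>C::real. \<forall>x n m. \<exists>u\<in>X n.
      norm (x - u) + norm (pseudoinverse (projected_operator A X Y n m) (A (x - u))) \<le> C * norm x" by blast
next
  assume "\<exists>C::real. \<forall>x n m. \<exists>u\<in>X n.
      norm (x - u) + norm (pseudoinverse (projected_operator A X Y n m) (A (x - u))) \<le> C * norm x"
  then obtain C where C: "\<And>x n m. \<exists>u\<in>X n.
      norm (x - u) + norm (pseudoinverse (projected_operator A X Y n m) (A (x - u))) \<le> C * norm x" by blast
  have "norm (pseudoinverse (projected_operator A X Y n m) (A x)) \<le> (1 + C) * norm x" for n m x
    using C[of n x m] norm_pseudoinverse_comp_le[OF finite_rank_projected_operator
        bounded_linear.linear[OF A] projected_operator_compat] by blast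
  then show "\<exists>M. \<forall>n m x. norm (pseudoinverse (projected_operator A X Y n m) (A x)) \<le> M * norm x" by blast
qed

lemma bound_imp_tendsto:
  assumes M: "\<And>n m x. norm (pseudoinverse (projected_operator A X Y n m) (A x)) \<le> M * norm x"
    and x: "x \<in> orthogonal_comp (nullspace A)"
  shows "((\<lambda>(n, m). pseudoinverse (projected_operator A X Y n m) (A x)) \<longlongrightarrow> x) (sequentially \<times>\<^sub>F sequentially)"
proof (rule tendstoI)
  fix e :: real assume "e > 0"
  note Xp = approximating_subspaces_projectable[OF X] and Yp = approximating_subspaces_projectable[OF Y]
  \<comment> \<open>Error budget: e/2 for replacing \<open>x\<close> by an element of the range of
    the adjoint, and e/4 for each of the projection errors in \<open>X n\<close> and
    \<open>Y m\<close>.\<close>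
  obtain y where y: "norm (x - adjoint A y) < e / 2"
    using range_adjoint_dense[OF A x, of "e / 2"] \<open>e > 0\<close> by auto
  let ?a = "\<lambda>n. (M + 1) * norm (x - orth_projector (X n) x)"
  let ?b = "\<lambda>m. onorm A * norm (y - orth_projector (Y m) y)"
  have ab: "?a \<longlonglongrightarrow> (M + 1) * norm (x - x)" "?b \<longlonglongrightarrow> onorm A * norm (y - y)"
    by (intro tendsto_intros orth_projector_tendsto X Y)+
  then have "\<forall>\<^sub>F n in sequentially. ?a n < e / 4" "\<forall>\<^sub>F m in sequentially. ?b m < e / 4"
    using order_tendstoD(2)[OF ab(1), of "e / 4"] order_tendstoD(2)[OF ab(2), of "e / 4"] \<open>e > 0\<close>
    by simp_all
  then obtain N1 N2 where N: "\<And>n. N1 \<le> n \<Longrightarrow> ?a n < e / 4" "\<And>m. N2 \<le> m \<Longrightarrow> ?b m < e / 4"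
    by (auto simp: eventually_sequentially)
  have main: "norm (pseudoinverse (projected_operator A X Y n m) (A x) - x) \<le> ?a n + (e / 2 + ?b m)" for n m
  proof (rule pseudoinverse_comp_error[OF finite_rank_projected_operator bounded_linear.linear[OF A]
        Xp _ projected_operator_compat M])
    show "orthogonal_comp (X n) \<subseteq> nullspace (projected_operator A X Y n m)"
    proof
      fix z assume "z \<in> orthogonal_comp (X n)"
      then have "orth_projector (X n) z = 0"
        by (intro orth_projector_eqI projectable_subspace[OF Xp]) (auto simp: subspace_0 projectable_subspace[OF Xp])
      then show "z \<in> nullspace (projected_operator A X Y n m)"
        using linear_0[OF bounded_linear.linear[OF A]]
          linear_0[OF bounded_linear.linear[OF bounded_linear_orth_projector[OF Yp]]]
        by (simp add: nullspace_def projected_operator_def)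
    qed
    show "0 \<le> e / 2 + ?b m"
      using \<open>e > 0\<close> onorm_pos_le[OF A] by (intro add_nonneg_nonneg mult_nonneg_nonneg) auto
    fix v assume v: "v \<in> X n" "v \<in> nullspace (projected_operator A X Y n m)"
    have "orth_projector (Y m) (A v) = 0"
      using v orth_projector_fixed[OF Xp v(1)] by (simp add: nullspace_def projected_operator_def)
    then have "A v \<bullet> orth_projector (Y m) y = 0"
      using orth_projector_selfadjoint[OF Yp, of m "A v" y] by simp
    \<comment> \<open>Since Q_m A v = 0, the vector \<open>A v\<close> sees only the residual of
      \<open>y\<close>, which is small for large m whatever n is.\<close>
    then have "x \<bullet> v = (x - adjoint A y) \<bullet> v + A v \<bullet> (y - orth_projector (Y m) y)"
      using hilbert_adjoint[OF A, of v y] by (simp add: inner_diff_left inner_diff_right inner_commute)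
    also have "\<dots> \<le> norm (x - adjoint A y) * norm v + norm (A v) * norm (y - orth_projector (Y m) y)"
      by (intro add_mono norm_cauchy_schwarz)
    also have "\<dots> \<le> e / 2 * norm v + (onorm A * norm v) * norm (y - orth_projector (Y m) y)"
      using y onorm[OF A] by (intro add_mono mult_right_mono) auto
    finally show "x \<bullet> v \<le> (e / 2 + ?b m) * norm v" by (simp add: algebra_simps)
  qed
  have "norm (pseudoinverse (projected_operator A X Y n m) (A x) - x) < e" if "max N1 N2 \<le> n" "max N1 N2 \<le> m" for n m
    using main[of n m] N(1)[of n] N(2)[of m] that by simp
  then show "\<forall>\<^sub>F p in sequentially \<times>\<^sub>F sequentially.
      dist (case p of (n, m) \<Rightarrow> pseudoinverse (projected_operator A X Y n m) (A x)) x < e"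
    unfolding eventually_prod_sequentially by (auto simp: dist_norm intro!: exI[of _ "max N1 N2"])
qed

lemma tendsto_imp_bound:
  assumes conv: "\<And>x. x \<in> orthogonal_comp (nullspace A) \<Longrightarrow>
    ((\<lambda>(n, m). pseudoinverse (projected_operator A X Y n m) (A x)) \<longlongrightarrow> x) (sequentially \<times>\<^sub>F sequentially)"
  shows "\<exists>M. \<forall>n m x. norm (pseudoinverse (projected_operator A X Y n m) (A x)) \<le> M * norm x"
proof -
  define f where "f n m x = pseudoinverse (projected_operator A X Y n m) (A x)" for n m x
  have f: "bounded_linear (f n m)" for n m unfolding f_def by (rule bounded_linear_pseudoinverse_comp)
  \<comment> \<open>One \<open>N\<close> is both threshold and bound. If none worked, there would be
    pairs (n k, m k) with both indices at least k and norm above k; joint convergence along this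
    sequence makes it pointwise bounded, against uniform boundedness.\<close>
  have "\<exists>N. \<forall>n\<ge>N. \<forall>m\<ge>N. onorm (f n m) \<le> real N"
  proof (rule ccontr)
    assume "\<not> ?thesis"
    then have "\<forall>k. \<exists>n m. k \<le> n \<and> k \<le> m \<and> real k < onorm (f n m)" by (meson not_le)
    then obtain n m where nm: "\<And>k. k \<le> n k" "\<And>k. k \<le> m k" "\<And>k. real k < onorm (f (n k) (m k))"
      by metis
    have "filterlim n sequentially sequentially" "filterlim m sequentially sequentially"
      using nm(1,2) by (auto intro!: filterlim_at_top_mono[OF filterlim_ident] always_eventually)
    then have lim: "filterlim (\<lambda>k. (n k, m k)) (sequentially \<times>\<^sub>F sequentially) sequentially"
      by (rule filterlim_Pair)
    have "bounded (range (\<lambda>k. f (n k) (m k) z))" for z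
    proof -
      note N = projectable_nullspace[OF A]
      \<comment> \<open>Convergence is assumed only on the complement of the nullspace; removing the
        nullspace component of \<open>z\<close> leaves \<open>A z\<close> unchanged and gives
        boundedness at every point.\<close>
      define x where "x = z - orth_projector (nullspace A) z"
      have "A x = A z"
        using orth_projector_props(1)[OF N, of z] linear_diff[OF bounded_linear.linear[OF A]]
        by (simp add: x_def nullspace_def)
      have "x \<in> orthogonal_comp (nullspace A)" unfolding x_def by (rule orth_projector_props(2)[OF N])
      from filterlim_compose[OF conv[OF this] lim]
      have "(\<lambda>k. f (n k) (m k) z) \<longlonglongrightarrow> x" by (simp add: f_def \<open>A x = A z\<close>)
      then show ?thesis by (rule convergent_imp_bounded)
    qed
    then obtain K where K: "\<And>k. onorm (f (n k) (m k)) \<le> K"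
      using bounded_linear_uniform_boundedness[of "\<lambda>k. f (n k) (m k)"] f by blast
    obtain k where "K < real k" using reals_Archimedean2 by blast
    then show False using nm(3)[of k] K[of k] by linarith
  qed
  then obtain N where N: "\<And>n m. N \<le> n \<Longrightarrow> N \<le> m \<Longrightarrow> onorm (f n m) \<le> real N" by blast
  have bound: "onorm (f n m) \<le> K * onorm A"
    if "0 \<le> K" "\<And>y. norm (pseudoinverse (projected_operator A X Y n m) y) \<le> K * norm y" for n m K
  proof (rule onorm_bound)
    show "0 \<le> K * onorm A" using that(1) onorm_pos_le[OF A] by simp
    fix x
    have "norm (f n m x) \<le> K * norm (A x)" unfolding f_def by (rule that(2))
    also have "\<dots> \<le> K * (onorm A * norm x)" using onorm[OF A] that(1) by (rule mult_left_mono)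
    finally show "norm (f n m x) \<le> K * onorm A * norm x" by simp
  qed
  have rows: "\<exists>L. \<forall>m. onorm (f n m) \<le> L" for n
    using pseudoinverse_bounded_range_refinement[OF A approximating_subspaces_finite_dim[OF X, of n] Y]
      bound unfolding projected_operator_def by blast
  have cols: "\<exists>L. \<forall>n. onorm (f n m) \<le> L" for m
    using pseudoinverse_bounded_domain_refinement[OF A approximating_subspaces_finite_dim[OF Y, of m] X]
      bound unfolding projected_operator_def by blast
  obtain L where L: "\<And>n m. onorm (f n m) \<le> L"
    using uniform_bound_product[of N "\<lambda>n m. onorm (f n m)", OF N rows cols] by blast
  have "norm (f n m x) \<le> L * norm x" for n m x
    using onorm[OF f, of n m x] mult_right_mono[OF L[of n m] norm_ge_zero[of x]] by linarith
  then show ?thesis unfolding f_def by blast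
qed

end

section \<open>The semidiscrete case, without projection in the target space\<close>

lemma semidiscrete_bound:
  fixes A :: "'a::{real_inner, complete_space} \<Rightarrow> 'b::{real_inner, complete_space}"
  assumes A: "bounded_linear A" and V: "finite_dim_subspace V"
    and C: "\<And>x. x \<in> orthogonal_comp (nullspace A) \<Longrightarrow> \<exists>u\<in>V. norm (x - u)
      + onorm (pseudoinverse (A \<circ> orth_projector V)) * norm (A (x - u)) \<le> C * norm x"
  shows "norm (pseudoinverse (A \<circ> orth_projector V) (A z)) \<le> (1 + \<bar>C\<bar>) * norm z"
proof -
  define T where "T = A \<circ> orth_projector V"
  have T: "finite_rank T" unfolding T_def by (rule finite_rank_comp_orth_projector[OF A V])
  note lin = bounded_linear.linear[OF A] and N = projectable_nullspace[OF A]
  \<comment> \<open>The approximation hypothesis covers only the complement of the nullspace, so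
    \<open>z\<close> is replaced by its component there, which has the same image and no larger
    norm.\<close>
  define x where "x = z - orth_projector (nullspace A) z"
  have "A x = A z"
    using orth_projector_props(1)[OF N, of z] by (simp add: x_def nullspace_def linear_diff[OF lin])
  have "x \<in> orthogonal_comp (nullspace A)" unfolding x_def by (rule orth_projector_props(2)[OF N])
  then obtain u where u: "u \<in> V"
    "norm (x - u) + onorm (pseudoinverse T) * norm (A (x - u)) \<le> C * norm x"
    using C unfolding T_def by blast
  have "A u - T u \<in> orthogonal_comp (range T)"
    using orth_projector_fixed[OF projectable_finite_dim[OF V] u(1)]
    by (simp add: T_def orthogonal_comp_iff)
  moreover have "norm (x - u) + norm (pseudoinverse T (A (x - u))) \<le> C * norm x"
    using u(2) onorm[OF bounded_linear_pseudoinverse[OF T], of "A (x - u)"] by linarith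
  ultimately have "norm (pseudoinverse T (A x)) \<le> (1 + C) * norm x"
    by (rule norm_pseudoinverse_comp_le[OF T lin])
  also have "\<dots> \<le> (1 + \<bar>C\<bar>) * norm x" by (intro mult_right_mono) auto
  also have "norm x \<le> norm z"
  proof -
    \<comment> \<open>Zero is the competitor in the closest-point property that yields
      \<open>norm x \<le> norm z\<close>.\<close>
    have "0 \<in> nullspace A" by (simp add: nullspace_def linear_0[OF lin])
    from orth_projector_closest[OF N this, of z] show ?thesis by (simp add: x_def)
  qed
  finally show ?thesis using \<open>A x = A z\<close> by (simp add: T_def mult_left_mono)
qed

text \<open>Here the error estimate applies with d = 0: on \<open>X n\<close> the operator agrees
  with \<open>A\<close>, so its null vectors there are null vectors of \<open>A\<close> and exactly
  orthogonal to \<open>x\<close>.\<close>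

lemma semidiscrete_tendsto:
  fixes A :: "'a::{real_inner, complete_space} \<Rightarrow> 'b::{real_inner, complete_space}"
  assumes A: "bounded_linear A" and X: "approximating_subspaces X"
    and M: "\<And>n z. norm (pseudoinverse (A \<circ> orth_projector (X n)) (A z)) \<le> M * norm z"
    and x: "x \<in> orthogonal_comp (nullspace A)"
  shows "(\<lambda>n. pseudoinverse (A \<circ> orth_projector (X n)) (A x)) \<longlonglongrightarrow> x"
proof -
  note Xp = approximating_subspaces_projectable[OF X]
  note lin = bounded_linear.linear[OF A]
  have "norm (pseudoinverse (A \<circ> orth_projector (X n)) (A x) - x)
      \<le> (M + 1) * norm (x - orth_projector (X n) x) + 0" for n
  proof (rule pseudoinverse_comp_error[OF _ lin Xp _ _ M])
    show "finite_rank (A \<circ> orth_projector (X n))"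
      by (rule finite_rank_comp_orth_projector[OF A approximating_subspaces_finite_dim[OF X]])
    show "orthogonal_comp (X n) \<subseteq> nullspace (A \<circ> orth_projector (X n))"
    proof
      fix z assume "z \<in> orthogonal_comp (X n)"
      then have "orth_projector (X n) z = 0"
        by (intro orth_projector_eqI projectable_subspace[OF Xp]) (auto simp: subspace_0 projectable_subspace[OF Xp])
      then show "z \<in> nullspace (A \<circ> orth_projector (X n))" by (simp add: nullspace_def linear_0[OF lin])
    qed
    show "A u - (A \<circ> orth_projector (X n)) u \<in> orthogonal_comp (range (A \<circ> orth_projector (X n)))"
      if "u \<in> X n" for u
      using orth_projector_fixed[OF Xp that] by (simp add: orthogonal_comp_iff)
    fix v assume v: "v \<in> X n" "v \<in> nullspace (A \<circ> orth_projector (X n))"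
    then have "v \<in> nullspace A" using orth_projector_fixed[OF Xp v(1)] by (simp add: nullspace_def)
    then show "x \<bullet> v \<le> 0 * norm v" using x by (simp add: orthogonal_comp_iff inner_commute)
  qed simp
  then have le: "\<forall>n. norm (pseudoinverse (A \<circ> orth_projector (X n)) (A x) - x)
      \<le> (M + 1) * norm (x - orth_projector (X n) x)" by simp
  have "(\<lambda>n. (M + 1) * norm (x - orth_projector (X n) x)) \<longlonglongrightarrow> (M + 1) * norm (x - x)"
    by (intro tendsto_intros orth_projector_tendsto X)
  then have "(\<lambda>n. (M + 1) * norm (x - orth_projector (X n) x)) \<longlonglongrightarrow> 0" by simp
  with always_eventually[OF le]
  have "(\<lambda>n. pseudoinverse (A \<circ> orth_projector (X n)) (A x) - x) \<longlonglongrightarrow> 0"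
    by (rule Lim_null_comparison)
  then show ?thesis by (rule LIM_zero_cancel)
qed

theorem proposition19:
  fixes A :: "'a::{real_inner, complete_space} \<Rightarrow> 'b::{real_inner, complete_space}"
    and X :: "nat \<Rightarrow> 'a set"
  assumes "bounded_linear A"
    and "approximating_subspaces X"
  shows
    "(\<forall>Y :: nat \<Rightarrow> 'b set. approximating_subspaces Y \<longrightarrow>
        (bdd_above (range (\<lambda>(n, m). onorm (pseudoinverse (projected_operator A X Y n m) \<circ> A)))
          \<longleftrightarrow> (\<exists>C::real. \<forall>x n m. \<exists>u\<in>X n.
                 norm (x - u) + norm (pseudoinverse (projected_operator A X Y n m) (A (x - u)))
                   \<le> C * norm x)) \<and>
        ((\<forall>x\<in>orthogonal_comp (nullspace A).
            ((\<lambda>(n, m). pseudoinverse (projected_operator A X Y n m) (A x)) \<longlongrightarrow> x)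
              (sequentially \<times>\<^sub>F sequentially))
          \<longleftrightarrow> (\<exists>C::real. \<forall>x n m. \<exists>u\<in>X n.
                 norm (x - u) + norm (pseudoinverse (projected_operator A X Y n m) (A (x - u)))
                   \<le> C * norm x)))
     \<and>
     ((\<exists>C::real. \<forall>x\<in>orthogonal_comp (nullspace A). \<forall>n. \<exists>u\<in>X n.
          norm (x - u)
            + onorm (pseudoinverse (A \<circ> orth_projector (X n))) * norm (A (x - u))
            \<le> C * norm x) \<longrightarrow>
        bdd_above (range (\<lambda>n. onorm (pseudoinverse (A \<circ> orth_projector (X n)) \<circ> A))) \<and>
        (\<forall>x\<in>orthogonal_comp (nullspace A).
           (\<lambda>n. pseudoinverse (A \<circ> orth_projector (X n)) (A x)) \<longlonglongrightarrow> x))"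
proof (intro conjI allI impI)
  fix Y :: "nat \<Rightarrow> 'b set" assume Y: "approximating_subspaces Y"
  note bound_iff = bound_iff_approximation[OF assms Y]
  show "bdd_above (range (\<lambda>(n, m). onorm (pseudoinverse (projected_operator A X Y n m) \<circ> A)))
      \<longleftrightarrow> (\<exists>C::real. \<forall>x n m. \<exists>u\<in>X n.
             norm (x - u) + norm (pseudoinverse (projected_operator A X Y n m) (A (x - u)))
               \<le> C * norm x)"
    using onorm_bdd_iff[OF assms Y] bound_iff by (rule trans)
  show "(\<forall>x\<in>orthogonal_comp (nullspace A).
        ((\<lambda>(n, m). pseudoinverse (projected_operator A X Y n m) (A x)) \<longlongrightarrow> x)
          (sequentially \<times>\<^sub>F sequentially))
      \<longleftrightarrow> (\<exists>C::real. \<forall>x n m. \<exists>u\<in>X n.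
             norm (x - u) + norm (pseudoinverse (projected_operator A X Y n m) (A (x - u)))
               \<le> C * norm x)"
    \<comment> \<open>Convergence is compared with the uniform bound, which stands in for the
      approximation condition.\<close>
    unfolding bound_iff[symmetric]
    using bound_imp_tendsto[OF assms Y] tendsto_imp_bound[OF assms Y] by blast
next
  assume "\<exists>C::real. \<forall>x\<in>orthogonal_comp (nullspace A). \<forall>n. \<exists>u\<in>X n.
      norm (x - u) + onorm (pseudoinverse (A \<circ> orth_projector (X n))) * norm (A (x - u))
        \<le> C * norm x"
  then obtain C :: real where "\<And>x n. x \<in> orthogonal_comp (nullspace A) \<Longrightarrow> \<exists>u\<in>X n.
      norm (x - u) + onorm (pseudoinverse (A \<circ> orth_projector (X n))) * norm (A (x - u))
        \<le> C * norm x" by blast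
  then have M: "norm (pseudoinverse (A \<circ> orth_projector (X n)) (A z)) \<le> (1 + \<bar>C\<bar>) * norm z" for n z
    by (intro semidiscrete_bound assms(1) approximating_subspaces_finite_dim[OF assms(2)])
  have "bounded_linear (pseudoinverse (A \<circ> orth_projector (X n)) \<circ> A)" for n
    unfolding o_def[of _ A]
    by (intro bounded_linear_compose[OF bounded_linear_pseudoinverse assms(1)]
        finite_rank_comp_orth_projector assms approximating_subspaces_finite_dim)
  moreover have "\<exists>K. \<forall>n z. norm ((pseudoinverse (A \<circ> orth_projector (X n)) \<circ> A) z) \<le> K * norm z"
    using M by (intro exI[of _ "1 + \<bar>C\<bar>"]) simp
  ultimately show "bdd_above (range (\<lambda>n. onorm (pseudoinverse (A \<circ> orth_projector (X n)) \<circ> A)))"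
    by (simp only: bdd_above_onorm_iff)
  show "\<forall>x\<in>orthogonal_comp (nullspace A).
      (\<lambda>n. pseudoinverse (A \<circ> orth_projector (X n)) (A x)) \<longlonglongrightarrow> x"
    using semidiscrete_tendsto[OF assms M] by blast
qed

end
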